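(* Let $X$, $\mathcal{Y}$, $\mathcal{S}$, $\mathcal{F}$, $N$, $\alpha_{t,\ell}$, $w_{t,\ell}$ and $T_{t,\ell}$ ($t\in\mathcal{S}$, $\ell\in\{1,\dots,N\}$) be as in the context and satisfy all the assumptions listed there. Then the following statements are equivalent. (1) The families $\{T_{t,1}\}_{t\in\mathcal{S}},\dots,\{T_{t,N}\}_{t\in\mathcal{S}}$ are $d\mathcal{F}$-semi-transitive on $\mathcal{Y}$. (2) For each $\varepsilon\in(0,1)$ and every compact subset $K$ of $X$ there exist some $F\in\mathcal{F}$ and a family $\{E_t\}_{t\in F}$ of Borel subsets of $K$ such that for all $t\in F$ $$\|\chi_{K\setminus E_t}\|_{\mathcal{Y}}<(4+2N)N\varepsilon,$$ $$\Bigl(\sup_{x\in E_t}w_{t,s}^{-1}(x)\Bigr)\cdot\Bigl(\sup_{x\in E_t}(w_{t,\ell}\circ\alpha_{t,\ell}^{-1})(x)\Bigr)<\frac{\varepsilon^2}{(1-\varepsilon)^2}$$ for all $\ell,s\in\{1,\dots,N\}$, and moreover, for all $t\in F$ and all distinct $s,\ell\in\{1,\dots,N\}$, $$\sup_{x\in E_t}\Biggl[\frac{(w_{t,\ell}\circ\alpha_{t,\ell}^{-1}\circ\alpha_{t,s})(x)}{w_{t,s}(x)}\Biggr]<\frac{\varepsilon}{1-\varepsilon}.$$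
   Context: $X$ is a topological space and $\mathcal{M}_0(X)$ is the space of all Borel measurable (complex-valued) functions on $X$. A Banach function space on $X$ is a linear subspace $\mathcal{Y}$ of $\mathcal{M}_0(X)$ with a norm $\|\cdot\|_{\mathcal{Y}}$ making it a Banach space. It is solid if $f\in\mathcal{Y}$, $g\in\mathcal{M}_0(X)$, $|g|\le|f|$ imply $g\in\mathcal{Y}$ and $\|g\|_{\mathcal{Y}}\le\|f\|_{\mathcal{Y}}$. For a homeomorphism $\beta$ of $X$, $\mathcal{Y}$ is $\beta$-invariant if for all $f\in\mathcal{Y}$, $f\circ\beta^{\pm1}\in\mathcal{Y}$ and $\|f\circ\beta^{\pm1}\|_{\mathcal{Y}}=\|f\|_{\mathcal{Y}}$. Standing assumptions: - $\mathcal{Y}$ is a solid Banach function space on $X$; $\chi_K\in\mathcal{Y}$ for every compact $K\subseteq X$; and the set $\mathcal{Y}_{bc}$ of all bounded compactly supported functions in $\mathcal{Y}$ is dense in $\mathcal{Y}$. - $\mathcal{S}$ is a set, $\mathcal{F}$ a family of subsets of $\mathcal{S}$, $N\in\mathbb{N}$; for $t\in\mathcal{S}$, $\ell\in\{1,\dots,N\}$, $\alpha_{t,\ell}$ is a homeomorphism of $X$ and $\mathcal{Y}$ is $\alpha_{t,\ell}$-invariant. - The system is disjoint aperiodic: for every compact $K\subseteq X$ and every $H\in\mathcal{F}$ there is some $F\in\mathcal{F}$ with $F\subseteq H$ such that for all $t\in F$, $K\cap\alpha_{t,\ell}(K)=\varnothing$ for all $\ell$, and $\alpha_{t,\ell}^{-1}(\alpha_{t,s}(K))\cap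 K=\varnothing$ for all distinct $s,\ell\in\{1,\dots,N\}$. - For $t\in\mathcal{S}$, $\ell\in\{1,\dots,N\}$, $w_{t,\ell}$ is a bounded positive measurable function on $X$ such that $w_{t,\ell}^{-1}:=1/w_{t,\ell}$ is bounded on compact subsets of $X$. The operators $T_{t,\ell}$ on $\mathcal{Y}$ are $T_{t,\ell}(f)=w_{t,\ell}\cdot(f\circ\alpha_{t,\ell})$. Definition. Families $\{T_{t,1}\}_{t\in\mathcal{S}},\dots,\{T_{t,N}\}_{t\in\mathcal{S}}$ of bounded linear operators on a Banach space $Z$ are $d\mathcal{F}$-semi-transitive if for all non-empty open subsets $\mathcal{O},V_1,\dots,V_N$ of $Z$ there is some $F\in\mathcal{F}$ such that for every $t\in F$ there is a real $\lambda_t>0$ with $\mathcal{O}\cap\lambda_tT_{t,1}^{-1}(V_1)\cap\dots\cap\lambda_tT_{t,N}^{-1}(V_N)\neq\varnothing$, where $T_{t,\ell}^{-1}(V_\ell)$ denotes the preimage. Convention: the supremum of a non-negative function over the empty set is $0$. *)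

theory Defs
  imports "HOL-Analysis.Analysis"
begin

text \<open>Measurable functions are genuine functions, not classes modulo null sets.\<close>

locale normed_function_space =
  fixes Y :: "('a::topological_space \<Rightarrow> complex) set"
    and nrm :: "('a \<Rightarrow> complex) \<Rightarrow> real"
  assumes measurable: "\<And>f. f \<in> Y \<Longrightarrow> f \<in> borel_measurable borel"
    and zero_mem: "(\<lambda>x. 0) \<in> Y"
    and add_mem: "\<And>f g. f \<in> Y \<Longrightarrow> g \<in> Y \<Longrightarrow> (\<lambda>x. f x + g x) \<in> Y"
    and scale_mem: "\<And>c f. f \<in> Y \<Longrightarrow> (\<lambda>x. c * f x) \<in> Y"
    and nrm_nonneg: "\<And>f. f \<in> Y \<Longrightarrow> 0 \<le> nrm f"
    and nrm_eq_0_iff: "\<And>f. f \<in> Y \<Longrightarrow> nrm f = 0 \<longleftrightarrow> f = (\<lambda>x. 0)"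
    and nrm_triangle: "\<And>f g. f \<in> Y \<Longrightarrow> g \<in> Y \<Longrightarrow> nrm (\<lambda>x. f x + g x) \<le> nrm f + nrm g"
    and nrm_scale: "\<And>c f. f \<in> Y \<Longrightarrow> nrm (\<lambda>x. c * f x) = cmod c * nrm f"

text \<open>The value outside \<open>Y\<close> is irrelevant; it is set to \<open>0\<close> only because
  \<^locale>\<open>Metric_space\<close> wants symmetry and nonnegativity on the whole type.\<close>

definition nrm_dist ::
  "('a \<Rightarrow> complex) set \<Rightarrow> (('a \<Rightarrow> complex) \<Rightarrow> real) \<Rightarrow> ('a \<Rightarrow> complex) \<Rightarrow> ('a \<Rightarrow> complex) \<Rightarrow> real" where
  "nrm_dist Y nrm f g = (if f \<in> Y \<and> g \<in> Y then nrm (\<lambda>x. f x - g x) else 0)"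

definition nrm_topology ::
  "('a \<Rightarrow> complex) set \<Rightarrow> (('a \<Rightarrow> complex) \<Rightarrow> real) \<Rightarrow> ('a \<Rightarrow> complex) topology" where
  "nrm_topology Y nrm = Metric_space.mtopology Y (nrm_dist Y nrm)"

context normed_function_space
begin

lemma diff_mem:
  assumes "f \<in> Y" "g \<in> Y"
  shows "(\<lambda>x. f x - g x) \<in> Y"
  using add_mem[OF assms(1) scale_mem[OF assms(2), of "-1"]] by simp

lemma Metric_space_nrm_dist: "Metric_space Y (nrm_dist Y nrm)"
proof
  fix f g h
  show "0 \<le> nrm_dist Y nrm f g"
    by (simp add: nrm_dist_def diff_mem nrm_nonneg)
  show "nrm_dist Y nrm f g = nrm_dist Y nrm g f"
    using nrm_scale[OF diff_mem, of f g "-1"] by (simp add: nrm_dist_def)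
  assume f: "f \<in> Y" and g: "g \<in> Y"
  show "nrm_dist Y nrm f g = 0 \<longleftrightarrow> f = g"
    using f g by (auto simp: nrm_dist_def nrm_eq_0_iff diff_mem fun_eq_iff)
  assume h: "h \<in> Y"
  show "nrm_dist Y nrm f h \<le> nrm_dist Y nrm f g + nrm_dist Y nrm g h"
    using nrm_triangle[OF diff_mem[OF f g] diff_mem[OF g h]] f g h by (simp add: nrm_dist_def)
qed

end

locale banach_function_space = normed_function_space +
  assumes complete: "Metric_space.mcomplete Y (nrm_dist Y nrm)"

locale solid_banach_function_space = banach_function_space +
  assumes solid: "\<And>f g. f \<in> Y \<Longrightarrow> g \<in> borel_measurable borel \<Longrightarrow>
      (\<And>x. cmod (g x) \<le> cmod (f x)) \<Longrightarrow> g \<in> Y \<and> nrm g \<le> nrm f"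

definition bounded_compactly_supported ::
  "('a::topological_space \<Rightarrow> complex) set \<Rightarrow> ('a \<Rightarrow> complex) set" where
  "bounded_compactly_supported Y =
     {f \<in> Y. bounded (range f) \<and> compact (closure {x. f x \<noteq> 0})}"

definition self_homeomorphism :: "('a::topological_space \<Rightarrow> 'a) \<Rightarrow> bool" where
  "self_homeomorphism \<beta> \<longleftrightarrow> homeomorphism UNIV UNIV \<beta> (inv \<beta>)"

definition comp_invariant ::
  "('a \<Rightarrow> complex) set \<Rightarrow> (('a \<Rightarrow> complex) \<Rightarrow> real) \<Rightarrow> ('a \<Rightarrow> 'a) \<Rightarrow> bool" where
  "comp_invariant Y nrm \<beta> \<longleftrightarrow>
     (\<forall>f\<in>Y. f \<circ> \<beta> \<in> Y \<and> nrm (f \<circ> \<beta>) = nrm f \<and>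
            f \<circ> inv \<beta> \<in> Y \<and> nrm (f \<circ> inv \<beta>) = nrm f)"

definition disjoint_aperiodic ::
  "'t set set \<Rightarrow> nat \<Rightarrow> ('t \<Rightarrow> nat \<Rightarrow> 'a::topological_space \<Rightarrow> 'a) \<Rightarrow> bool" where
  "disjoint_aperiodic \<F> N \<alpha> \<longleftrightarrow>
     (\<forall>K H. compact K \<longrightarrow> H \<in> \<F> \<longrightarrow>
        (\<exists>F\<in>\<F>. F \<subseteq> H \<and> (\<forall>t\<in>F.
           (\<forall>l\<in>{1..N}. K \<inter> \<alpha> t l ` K = {}) \<and>
           (\<forall>s\<in>{1..N}. \<forall>l\<in>{1..N}. s \<noteq> l \<longrightarrow> inv (\<alpha> t l) ` (\<alpha> t s ` K) \<inter> K = {}))))"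

definition admissible_weight :: "('a::topological_space \<Rightarrow> real) \<Rightarrow> bool" where
  "admissible_weight w \<longleftrightarrow>
     w \<in> borel_measurable borel \<and> (\<forall>x. 0 < w x) \<and> bounded (range w) \<and>
     (\<forall>K. compact K \<longrightarrow> bounded ((\<lambda>x. 1 / w x) ` K))"

definition weighted_comp ::
  "('a \<Rightarrow> real) \<Rightarrow> ('a \<Rightarrow> 'a) \<Rightarrow> ('a \<Rightarrow> complex) \<Rightarrow> 'a \<Rightarrow> complex" where
  "weighted_comp w \<beta> f = (\<lambda>x. complex_of_real (w x) * f (\<beta> x))"

text \<open>The space enters through its norm topology, whose \<^const>\<open>topspace\<close> is the carrier,
  and its multiplication by real scalars.\<close>

definition d_semi_transitive ::
  "'z topology \<Rightarrow> (real \<Rightarrow> 'z \<Rightarrow> 'z) \<Rightarrow> 't set set \<Rightarrow> nat \<Rightarrow> ('t \<Rightarrow> nat \<Rightarrow> 'z \<Rightarrow> 'z) \<Rightarrow> bool" where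
  "d_semi_transitive Z smul \<F> N T \<longleftrightarrow>
     (\<forall>U V. openin Z U \<and> U \<noteq> {} \<and> (\<forall>l\<in>{1..N}. openin Z (V l) \<and> V l \<noteq> {}) \<longrightarrow>
        (\<exists>F\<in>\<F>. \<forall>t\<in>F. \<exists>c>0.
           U \<inter> (\<Inter>l\<in>{1..N}. smul c ` {z \<in> topspace Z. T t l z \<in> V l}) \<noteq> {}))"

lemma (in solid_banach_function_space) weighted_comp_bounded:
  assumes \<beta>: "self_homeomorphism \<beta>" "comp_invariant Y nrm \<beta>" and w: "admissible_weight w"
  shows "\<exists>C. \<forall>f\<in>Y. weighted_comp w \<beta> f \<in> Y \<and> nrm (weighted_comp w \<beta> f) \<le> C * nrm f"
proof -
  obtain C where C: "\<And>x. \<bar>w x\<bar> \<le> C" and "0 < C"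
    using w by (auto simp: admissible_weight_def bounded_pos)
  show ?thesis
  proof (intro exI ballI)
    fix f assume f: "f \<in> Y"
    have f\<beta>: "f \<circ> \<beta> \<in> Y" "nrm (f \<circ> \<beta>) = nrm f"
      using f \<beta>(2) by (auto simp: comp_invariant_def)
    have "(\<lambda>x. f (\<beta> x)) \<in> borel_measurable borel"
      using measurable[OF f\<beta>(1)] by (simp add: o_def)
    then have "weighted_comp w \<beta> f \<in> borel_measurable borel"
      using w unfolding weighted_comp_def admissible_weight_def
      by (intro borel_measurable_times borel_measurable_of_real) auto
    moreover have "cmod (weighted_comp w \<beta> f x) \<le> cmod (complex_of_real C * (f \<circ> \<beta>) x)" for x
      using C[of x] \<open>0 < C\<close> by (simp add: weighted_comp_def norm_mult mult_right_mono)
    ultimately have "weighted_comp w \<beta> f \<in> Y \<and>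
        nrm (weighted_comp w \<beta> f) \<le> nrm (\<lambda>x. complex_of_real C * (f \<circ> \<beta>) x)"
      using solid[OF scale_mem[OF f\<beta>(1)]] by blast
    then show "weighted_comp w \<beta> f \<in> Y \<and> nrm (weighted_comp w \<beta> f) \<le> C * nrm f"
      using nrm_scale[OF f\<beta>(1), of "complex_of_real C"] f\<beta>(2) \<open>0 < C\<close> by simp
  qed
qed

end

theory Submission
  imports Defs
begin

text \<open>
  Both implications are pointwise arguments carried out for one \<open>t\<close> at a time.

  Necessity. Apply semi-transitivity to small balls around \<open>\<chi>\<^sub>K\<close>. It yields \<open>f\<close> and a
  scalar \<open>\<mu> > 0\<close> such that \<open>f\<close> and all \<open>\<mu> T\<^sub>l f\<close> are close to \<open>\<chi>\<^sub>K\<close> in norm. In a solid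
  space norm-closeness gives pointwise closeness off a set with small indicator norm (a
  Chebyshev inequality), and by invariance this also holds along the maps \<open>\<alpha>\<^sub>l\<close>,
  \<open>\<alpha>\<^sub>l\<inverse>\<close> and \<open>\<alpha>\<^sub>l\<inverse> \<circ> \<alpha>\<^sub>s\<close>. These maps (the last for \<open>s \<noteq> l\<close>) push \<open>K\<close> off itself,
  where \<open>\<chi>\<^sub>K\<close> vanishes. So on most of \<open>K\<close> the numbers \<open>f(x)\<close> and
  \<open>\<mu> w\<^sub>l(x) f(\<alpha>\<^sub>l x)\<close> are near \<open>1\<close>, while \<open>f(\<alpha>\<^sub>l x)\<close>, \<open>\<mu> w\<^sub>l(\<alpha>\<^sub>l\<inverse> x) f(x)\<close> and
  \<open>\<mu> w\<^sub>l(\<alpha>\<^sub>l\<inverse> \<alpha>\<^sub>s x) f(\<alpha>\<^sub>s x)\<close> are near \<open>0\<close>; dividing these relations by one another bounds the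
  weights (lemma \<open>weights_small_from_near_indicators\<close>).

  Sufficiency. By density the targets may be taken bounded with support in one
  compact \<open>K\<close>. Cut them down to \<open>E\<^sub>t\<close> and put \<open>v = f \<chi>\<^sub>E + \<mu>\<inverse> \<Sum>\<^sub>s R\<^sub>s (g\<^sub>s \<chi>\<^sub>E)\<close>, where
  \<open>R\<^sub>s h = (h / w\<^sub>s) \<circ> \<alpha>\<^sub>s\<inverse>\<close> is a right inverse of \<open>T\<^sub>s\<close>. The weight bounds make \<open>v\<close> close to
  \<open>f\<close> and every \<open>\<mu> T\<^sub>l v\<close> close to \<open>g\<^sub>l\<close> (lemma \<open>approximate_from_weights_small\<close>).

  The two halves meet in the predicate \<open>weights_small E \<mu> \<eta>\<close>. Up to strictness of the
  inequalities, the product condition on suprema says that \<open>w\<^sub>s\<inverse>\<close> and \<open>w\<^sub>l \<circ> \<alpha>\<^sub>l\<inverse>\<close> can be balanced by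
  a single scalar \<open>\<mu>\<close>, so that \<open>w\<^sub>s\<inverse> \<le> \<mu> \<eta>\<close> and \<open>w\<^sub>l \<circ> \<alpha>\<^sub>l\<inverse> \<le> \<eta> / \<mu>\<close> on \<open>E\<close>; this is where the
  freedom to choose \<open>\<lambda>\<^sub>t\<close> comes from.
\<close>

section \<open>Estimates in solid function spaces\<close>

context normed_function_space
begin

lemma topspace_nrm_topology: "topspace (nrm_topology Y nrm) = Y"
  by (simp add: nrm_topology_def Metric_space.topspace_mtopology[OF Metric_space_nrm_dist])

lemma openin_nrm_topology_iff:
  "openin (nrm_topology Y nrm) U \<longleftrightarrow>
     U \<subseteq> Y \<and> (\<forall>f\<in>U. \<exists>r>0. \<forall>g\<in>Y. nrm (\<lambda>x. f x - g x) < r \<longrightarrow> g \<in> U)"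
proof -
  have "Metric_space.mball Y (nrm_dist Y nrm) f r \<subseteq> U \<longleftrightarrow>
      (\<forall>g\<in>Y. nrm (\<lambda>x. f x - g x) < r \<longrightarrow> g \<in> U)" if "f \<in> Y" for f r
    using that by (auto simp: Metric_space.mball_def[OF Metric_space_nrm_dist] nrm_dist_def)
  then show ?thesis
    unfolding nrm_topology_def Metric_space.openin_mtopology[OF Metric_space_nrm_dist] by blast
qed

lemma openin_nrm_ball:
  assumes "f \<in> Y"
  shows "openin (nrm_topology Y nrm) {g \<in> Y. nrm (\<lambda>x. f x - g x) < r}"
proof -
  have "{g \<in> Y. nrm (\<lambda>x. f x - g x) < r} = Metric_space.mball Y (nrm_dist Y nrm) f r"
    using assms by (auto simp: Metric_space.mball_def[OF Metric_space_nrm_dist] nrm_dist_def)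
  then show ?thesis
    unfolding nrm_topology_def
    using Metric_space.openin_mball[OF Metric_space_nrm_dist] by simp
qed

lemma nrm_zero: "nrm (\<lambda>x. 0) = 0"
  using nrm_eq_0_iff[OF zero_mem] by simp

lemma nrm_diff_le:
  assumes "f \<in> Y" "g \<in> Y"
  shows "nrm (\<lambda>x. f x - g x) \<le> nrm f + nrm g"
  using nrm_triangle[OF assms(1) scale_mem[OF assms(2), of "-1"]] nrm_scale[OF assms(2), of "-1"]
  by simp

lemma sum_mem_nrm_le:
  assumes "finite I" and "\<And>i. i \<in> I \<Longrightarrow> u i \<in> Y" and "\<And>i. i \<in> I \<Longrightarrow> nrm (u i) \<le> c"
  shows "(\<lambda>x. \<Sum>i\<in>I. u i x) \<in> Y \<and> nrm (\<lambda>x. \<Sum>i\<in>I. u i x) \<le> real (card I) * c"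
  using assms
proof (induction I rule: finite_induct)
  case empty
  then show ?case by (simp add: zero_mem nrm_zero)
next
  case (insert i I)
  then have IH: "(\<lambda>x. \<Sum>i\<in>I. u i x) \<in> Y" "nrm (\<lambda>x. \<Sum>i\<in>I. u i x) \<le> real (card I) * c"
    and i: "u i \<in> Y" "nrm (u i) \<le> c" by auto
  show ?case
    using add_mem[OF i(1) IH(1)] nrm_triangle[OF i(1) IH(1)] IH(2) i(2) insert.hyps
    by (simp add: algebra_simps)
qed

definition comp_isometry :: "('a \<Rightarrow> 'a) \<Rightarrow> bool" where
  "comp_isometry \<sigma> \<longleftrightarrow> (\<forall>f\<in>Y. f \<circ> \<sigma> \<in> Y \<and> nrm (f \<circ> \<sigma>) = nrm f)"

lemma comp_isometry_id: "comp_isometry id"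
  by (simp add: comp_isometry_def)

lemma comp_isometry_comp:
  assumes "comp_isometry \<sigma>" "comp_isometry \<tau>"
  shows "comp_isometry (\<sigma> \<circ> \<tau>)"
  unfolding comp_isometry_def
proof
  fix f assume f: "f \<in> Y"
  have "f \<circ> (\<sigma> \<circ> \<tau>) = (f \<circ> \<sigma>) \<circ> \<tau>" by (simp add: o_assoc)
  then show "f \<circ> (\<sigma> \<circ> \<tau>) \<in> Y \<and> nrm (f \<circ> (\<sigma> \<circ> \<tau>)) = nrm f"
    using assms f unfolding comp_isometry_def by metis
qed

end

context solid_banach_function_space
begin

text \<open>Solidity and invariance are always used together: a function is controlled by
  comparing it, at every point, with a known element evaluated at a moved point.\<close>

lemma solid_along_isometry:
  assumes "f \<in> Y" "comp_isometry \<sigma>" "g \<in> borel_measurable borel" "0 \<le> C"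
    and le: "\<And>x. cmod (g x) \<le> C * cmod (f (\<sigma> x))"
  shows "g \<in> Y" "nrm g \<le> C * nrm f"
proof -
  have f\<sigma>: "f \<circ> \<sigma> \<in> Y" "nrm (f \<circ> \<sigma>) = nrm f"
    using assms(1,2) by (auto simp: comp_isometry_def)
  have "cmod (g x) \<le> cmod (complex_of_real C * (f \<circ> \<sigma>) x)" for x
    using le[of x] \<open>0 \<le> C\<close> by (simp add: norm_mult)
  then have "g \<in> Y \<and> nrm g \<le> nrm (\<lambda>x. complex_of_real C * (f \<circ> \<sigma>) x)"
    by (rule solid[OF scale_mem[OF f\<sigma>(1)] assms(3)])
  then show "g \<in> Y" "nrm g \<le> C * nrm f"
    using nrm_scale[OF f\<sigma>(1), of "complex_of_real C"] f\<sigma>(2) \<open>0 \<le> C\<close> by auto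
qed

text \<open>The Chebyshev inequality: where a moved copy of \<open>f\<close> is at least \<open>\<delta>\<close>, the
  indicator is dominated by that copy divided by \<open>\<delta>\<close>. Norm at most \<open>\<delta>\<^sup>2\<close> therefore leaves
  \<open>\<delta>\<close>, so that one number measures both the pointwise error and the size of the exceptional
  set.\<close>

lemma nrm_indicator_large_set:
  assumes f: "f \<in> Y" and \<sigma>: "comp_isometry \<sigma>" and K: "K \<in> sets borel"
    and "0 < \<delta>" and nrm: "nrm f \<le> \<delta>\<^sup>2"
  defines "B \<equiv> {x \<in> K. \<delta> \<le> cmod (f (\<sigma> x))}"
  shows "B \<in> sets borel" "indicator B \<in> Y" "nrm (indicator B) \<le> \<delta>"
proof -
  have "f \<circ> \<sigma> \<in> Y" using f \<sigma> by (auto simp: comp_isometry_def)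
  then have "(\<lambda>x. f (\<sigma> x)) \<in> borel_measurable borel"
    using measurable[of "f \<circ> \<sigma>"] by (simp add: o_def)
  then have "{x \<in> space borel. \<delta> \<le> cmod (f (\<sigma> x))} \<in> sets borel"
    by measurable
  then have "K \<inter> {x. \<delta> \<le> cmod (f (\<sigma> x))} \<in> sets borel"
    using K by (intro sets.Int) simp_all
  then show B: "B \<in> sets borel" by (simp add: B_def Collect_conj_eq)
  have le: "cmod (indicator B x) \<le> 1 / \<delta> * cmod (f (\<sigma> x))" for x
    using \<open>0 < \<delta>\<close> by (auto simp: B_def indicator_def field_simps)
  have ind: "(indicator B :: 'a \<Rightarrow> complex) \<in> borel_measurable borel"
    using B by simp
  have \<delta>0: "0 \<le> 1 / \<delta>" using \<open>0 < \<delta>\<close> by simp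
  show "indicator B \<in> Y"
    by (rule solid_along_isometry(1)[OF f \<sigma> ind \<delta>0 le])
  have "nrm (indicator B) \<le> 1 / \<delta> * nrm f"
    by (rule solid_along_isometry(2)[OF f \<sigma> ind \<delta>0 le])
  also have "\<dots> \<le> 1 / \<delta> * \<delta>\<^sup>2" using nrm \<delta>0 by (rule mult_left_mono)
  finally show "nrm (indicator B) \<le> \<delta>"
    using \<open>0 < \<delta>\<close> by (simp add: power2_eq_square)
qed

lemma nrm_indicator_Union_le:
  assumes "finite \<B>" and B: "\<And>B. B \<in> \<B> \<Longrightarrow> B \<in> sets borel"
    and "\<And>B. B \<in> \<B> \<Longrightarrow> indicator B \<in> Y" "\<And>B. B \<in> \<B> \<Longrightarrow> nrm (indicator B) \<le> \<delta>"
  shows "nrm (indicator (\<Union>\<B>)) \<le> real (card \<B>) * \<delta>"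
proof -
  let ?u = "\<lambda>x. \<Sum>B\<in>\<B>. (indicator B x :: complex)"
  have u: "?u \<in> Y" "nrm ?u \<le> real (card \<B>) * \<delta>"
    using sum_mem_nrm_le[OF assms(1,3,4)] by auto
  have "cmod (indicator (\<Union>\<B>) x) \<le> cmod (?u x)" for x
  proof (cases "x \<in> \<Union>\<B>")
    case True
    then obtain B where "B \<in> \<B>" "x \<in> B" by blast
    then have "(1::real) \<le> (\<Sum>B\<in>\<B>. indicator B x)"
      using member_le_sum[of B \<B> "\<lambda>B. indicator B x :: real"] assms(1) by simp
    moreover have "?u x = complex_of_real (\<Sum>B\<in>\<B>. indicator B x)"
      by (simp add: indicator_def of_real_sum) (rule sum.cong, auto)
    ultimately show ?thesis using True by (simp del: of_real_sum)
  qed simp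
  moreover have "(indicator (\<Union>\<B>) :: 'a \<Rightarrow> complex) \<in> borel_measurable borel"
    using assms(1) B by (intro borel_measurable_indicator sets.finite_Union) auto
  ultimately show ?thesis using solid[OF u(1)] u(2) by force
qed

end

section \<open>Finite tuples of weighted composition operators\<close>

locale weighted_comp_tuple = solid_banach_function_space Y nrm
  for Y :: "('a::topological_space \<Rightarrow> complex) set" and nrm :: "('a \<Rightarrow> complex) \<Rightarrow> real" +
  fixes N :: nat and \<alpha> :: "nat \<Rightarrow> 'a \<Rightarrow> 'a" and w :: "nat \<Rightarrow> 'a \<Rightarrow> real"
  assumes homeomorphism: "\<And>l. l \<in> {1..N} \<Longrightarrow> self_homeomorphism (\<alpha> l)"
    and invariant: "\<And>l. l \<in> {1..N} \<Longrightarrow> comp_invariant Y nrm (\<alpha> l)"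
    and weight: "\<And>l. l \<in> {1..N} \<Longrightarrow> admissible_weight (w l)"
begin

lemma inv_left [simp]: "l \<in> {1..N} \<Longrightarrow> inv (\<alpha> l) (\<alpha> l x) = x"
  and inv_right [simp]: "l \<in> {1..N} \<Longrightarrow> \<alpha> l (inv (\<alpha> l) x) = x"
  using homeomorphism[of l] by (auto simp: self_homeomorphism_def homeomorphism_def)

lemma measurable_\<alpha>: "l \<in> {1..N} \<Longrightarrow> \<alpha> l \<in> borel_measurable borel"
  and measurable_inv_\<alpha>: "l \<in> {1..N} \<Longrightarrow> inv (\<alpha> l) \<in> borel_measurable borel"
  using homeomorphism[of l]
  by (auto simp: self_homeomorphism_def homeomorphism_def intro: borel_measurable_continuous_onI)

lemma comp_isometry_\<alpha>: "l \<in> {1..N} \<Longrightarrow> comp_isometry (\<alpha> l)"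
  and comp_isometry_inv_\<alpha>: "l \<in> {1..N} \<Longrightarrow> comp_isometry (inv (\<alpha> l))"
  using invariant[of l] by (auto simp: comp_invariant_def comp_isometry_def)

lemma w_pos: "l \<in> {1..N} \<Longrightarrow> 0 < w l x"
  and w_measurable: "l \<in> {1..N} \<Longrightarrow> w l \<in> borel_measurable borel"
  using weight[of l] by (auto simp: admissible_weight_def)

lemma weighted_comp_mem: "l \<in> {1..N} \<Longrightarrow> f \<in> Y \<Longrightarrow> weighted_comp (w l) (\<alpha> l) f \<in> Y"
  using weighted_comp_bounded[OF homeomorphism invariant weight] by blast

text \<open>\<open>\<mu>\<close> stands for \<open>1 / \<lambda>\<^sub>t\<close>, the factor by which the operators are rescaled: the first bound
  says that the right inverses of \<open>\<mu> T\<^sub>l\<close> are small on functions supported in \<open>E\<close>, the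
  second that \<open>\<mu> T\<^sub>l\<close> itself is, the third that \<open>T\<^sub>l\<close> is small after the right inverse of
  \<open>T\<^sub>s\<close>. The third needs no scalar since both operators are rescaled alike.\<close>

definition weights_small :: "'a set \<Rightarrow> real \<Rightarrow> real \<Rightarrow> bool" where
  "weights_small E \<mu> \<eta> \<longleftrightarrow> (\<forall>l\<in>{1..N}. \<forall>x\<in>E.
     1 / w l x \<le> \<mu> * \<eta> \<and> w l (inv (\<alpha> l) x) \<le> \<eta> / \<mu> \<and>
     (\<forall>s\<in>{1..N}. s \<noteq> l \<longrightarrow> w l (inv (\<alpha> l) (\<alpha> s x)) / w s x \<le> \<eta>))"

text \<open>The scalar that balances the two families is the supremum of the numbers
  \<open>1 / w\<^sub>s(x)\<close> divided by \<open>\<eta>\<close>. That supremum is finite because a single positive value of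
  some \<open>w\<^sub>l \<circ> \<alpha>\<^sub>l\<inverse>\<close> already bounds all these numbers through the product condition.\<close>

lemma weights_small_if_sup_small:
  assumes "0 < \<eta>"
    and prod: "\<And>l s. l \<in> {1..N} \<Longrightarrow> s \<in> {1..N} \<Longrightarrow>
      (SUP x\<in>E. ennreal (1 / w s x)) * (SUP x\<in>E. ennreal (w l (inv (\<alpha> l) x))) < ennreal (\<eta>\<^sup>2)"
    and ratio: "\<And>l s. l \<in> {1..N} \<Longrightarrow> s \<in> {1..N} \<Longrightarrow> s \<noteq> l \<Longrightarrow>
      (SUP x\<in>E. ennreal (w l (inv (\<alpha> l) (\<alpha> s x)) / w s x)) < ennreal \<eta>"
  shows "\<exists>\<mu>>0. weights_small E \<mu> \<eta>"
proof (cases "{1..N} \<times> E = {}")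
  case True
  then have "weights_small E 1 \<eta>" by (auto simp: weights_small_def)
  then show ?thesis by (intro exI[of _ 1]) simp
next
  case False
  then obtain l0 x0 where 0: "l0 \<in> {1..N}" "x0 \<in> E" by blast
  have prod': "1 / w s x * w l (inv (\<alpha> l) y) \<le> \<eta>\<^sup>2"
    if "l \<in> {1..N}" "s \<in> {1..N}" "x \<in> E" "y \<in> E" for l s x y
  proof -
    have "ennreal (1 / w s x * w l (inv (\<alpha> l) y)) =
        ennreal (1 / w s x) * ennreal (w l (inv (\<alpha> l) y))"
      using w_pos[OF that(1)] w_pos[OF that(2)] by (intro ennreal_mult) (simp_all add: less_imp_le)
    also have "\<dots> \<le> (SUP x\<in>E. ennreal (1 / w s x)) * (SUP x\<in>E. ennreal (w l (inv (\<alpha> l) x)))"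
      using that by (intro mult_mono SUP_upper) auto
    also have "\<dots> < ennreal (\<eta>\<^sup>2)" using prod that by blast
    finally show ?thesis by (meson ennreal_leI leD le_cases)
  qed
  have ratio': "w l (inv (\<alpha> l) (\<alpha> s x)) / w s x \<le> \<eta>"
    if "l \<in> {1..N}" "s \<in> {1..N}" "s \<noteq> l" "x \<in> E" for l s x
  proof -
    have "ennreal (w l (inv (\<alpha> l) (\<alpha> s x)) / w s x) \<le>
        (SUP x\<in>E. ennreal (w l (inv (\<alpha> l) (\<alpha> s x)) / w s x))"
      using that by (intro SUP_upper)
    also have "\<dots> < ennreal \<eta>" using ratio that by blast
    finally show ?thesis by (meson ennreal_leI leD le_cases)
  qed
  let ?P = "{1..N} \<times> E"
  define A where "A = (SUP (s, x)\<in>?P. 1 / w s x)"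
  have bdd: "bdd_above ((\<lambda>(s, x). 1 / w s x) ` ?P)"
  proof (intro bdd_aboveI2[where M = "\<eta>\<^sup>2 / w l0 (inv (\<alpha> l0) x0)"], clarify)
    fix s x assume "s \<in> {1..N}" "x \<in> E"
    then show "1 / w s x \<le> \<eta>\<^sup>2 / w l0 (inv (\<alpha> l0) x0)"
      using prod'[of l0 s x x0] 0 w_pos[OF 0(1)] by (simp add: pos_le_divide_eq)
  qed
  have A: "1 / w s x \<le> A" if "s \<in> {1..N}" "x \<in> E" for s x
    using cSUP_upper[OF _ bdd, of "(s, x)"] that by (simp add: A_def)
  have "0 < A" using A[OF 0] w_pos[OF 0(1), of x0] by (smt (verit) zero_less_divide_1_iff)
  have A': "w l (inv (\<alpha> l) y) \<le> \<eta> / (A / \<eta>)" if l: "l \<in> {1..N}" and y: "y \<in> E" for l y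
  proof -
    have wp: "0 < w l (inv (\<alpha> l) y)" by (rule w_pos[OF l])
    have "A \<le> \<eta>\<^sup>2 / w l (inv (\<alpha> l) y)"
      unfolding A_def
    proof (rule cSUP_least[OF False], clarify)
      fix s x assume "s \<in> {1..N}" "x \<in> E"
      then show "1 / w s x \<le> \<eta>\<^sup>2 / w l (inv (\<alpha> l) y)"
        using prod'[of l s x y] l y wp by (simp add: pos_le_divide_eq)
    qed
    then have "w l (inv (\<alpha> l) y) * A \<le> \<eta>\<^sup>2"
      using wp by (simp add: pos_le_divide_eq mult.commute)
    then show ?thesis
      using \<open>0 < A\<close> by (simp add: pos_le_divide_eq power2_eq_square)
  qed
  have "weights_small E (A / \<eta>) \<eta>"
    unfolding weights_small_def using A A' ratio' \<open>0 < \<eta>\<close> by auto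
  then show ?thesis
    using \<open>0 < A\<close> \<open>0 < \<eta>\<close> by (intro exI[of _ "A / \<eta>"]) simp
qed

lemma sup_small_if_weights_small:
  assumes small: "weights_small E \<mu> \<eta>" and "0 < \<mu>" "0 \<le> \<eta>" "\<eta> < \<eta>'"
    and l: "l \<in> {1..N}" and s: "s \<in> {1..N}"
  shows "(SUP x\<in>E. ennreal (1 / w s x)) * (SUP x\<in>E. ennreal (w l (inv (\<alpha> l) x))) < ennreal (\<eta>'\<^sup>2)"
    and "s \<noteq> l \<Longrightarrow> (SUP x\<in>E. ennreal (w l (inv (\<alpha> l) (\<alpha> s x)) / w s x)) < ennreal \<eta>'"
proof -
  have "(SUP x\<in>E. ennreal (1 / w s x)) * (SUP x\<in>E. ennreal (w l (inv (\<alpha> l) x)))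
      \<le> ennreal (\<mu> * \<eta>) * ennreal (\<eta> / \<mu>)"
    using small l s by (intro mult_mono SUP_least ennreal_leI) (auto simp: weights_small_def)
  also have "\<dots> = ennreal (\<eta>\<^sup>2)"
    using \<open>0 < \<mu>\<close> \<open>0 \<le> \<eta>\<close> by (simp flip: ennreal_mult add: power2_eq_square)
  also have "\<dots> < ennreal (\<eta>'\<^sup>2)"
    using assms(3,4) by (intro ennreal_lessI power_strict_mono) auto
  finally show "(SUP x\<in>E. ennreal (1 / w s x)) * (SUP x\<in>E. ennreal (w l (inv (\<alpha> l) x)))
      < ennreal (\<eta>'\<^sup>2)" .
  assume "s \<noteq> l"
  then have "(SUP x\<in>E. ennreal (w l (inv (\<alpha> l) (\<alpha> s x)) / w s x)) \<le> ennreal \<eta>"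
    using small l s by (intro SUP_least ennreal_leI) (auto simp: weights_small_def)
  also have "\<dots> < ennreal \<eta>'" using assms(3,4) by (intro ennreal_lessI) auto
  finally show "(SUP x\<in>E. ennreal (w l (inv (\<alpha> l) (\<alpha> s x)) / w s x)) < ennreal \<eta>'" .
qed

section \<open>From approximation to small weights\<close>

text \<open>\<open>E\<close> is what remains of \<open>K\<close> when all sets are removed on which one of the errors
  \<open>u\<^sub>0 = \<chi>\<^sub>K - f\<close> and \<open>u\<^sub>l = \<chi>\<^sub>K - \<mu> T\<^sub>l f\<close>, read along one of the maps \<open>id\<close>, \<open>\<alpha>\<^sub>l\<close>, \<open>\<alpha>\<^sub>l\<inverse>\<close> or
  \<open>\<alpha>\<^sub>l\<inverse> \<circ> \<alpha>\<^sub>s\<close>, is at least \<open>\<delta>\<close>. There are at most \<open>1 + 2 N + N\<^sup>2\<close> of them, since the maps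
  \<open>\<alpha>\<^sub>l\<inverse> \<circ> \<alpha>\<^sub>s\<close> with \<open>s = l\<close> account for the error \<open>u\<^sub>l\<close> on \<open>K\<close> itself.\<close>

lemma weights_small_from_near_indicators:
  assumes K: "indicator K \<in> Y"
    and off: "\<And>l. l \<in> {1..N} \<Longrightarrow> K \<inter> \<alpha> l ` K = {}"
    and off2: "\<And>s l. s \<in> {1..N} \<Longrightarrow> l \<in> {1..N} \<Longrightarrow> s \<noteq> l \<Longrightarrow> inv (\<alpha> l) ` (\<alpha> s ` K) \<inter> K = {}"
    and f: "f \<in> Y" and "0 < \<mu>" "0 < \<delta>" "\<delta> < 1"
    and f_near: "nrm (\<lambda>x. indicator K x - f x) \<le> \<delta>\<^sup>2"
    and T_near: "\<And>l. l \<in> {1..N} \<Longrightarrow>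
      nrm (\<lambda>x. indicator K x - complex_of_real \<mu> * weighted_comp (w l) (\<alpha> l) f x) \<le> \<delta>\<^sup>2"
  obtains E where "E \<in> sets borel" "E \<subseteq> K" "nrm (indicator (K - E)) \<le> (real N + 1)\<^sup>2 * \<delta>"
    "weights_small E \<mu> (\<delta> / (1 - \<delta>))"
proof -
  let ?I = "{1..N}"
  have Kb: "K \<in> sets borel"
    using measurable[OF K] by (simp add: borel_measurable_indicator_iff)
  define u0 where "u0 = (\<lambda>x. indicator K x - f x)"
  define u where "u l = (\<lambda>x. indicator K x - complex_of_real \<mu> * weighted_comp (w l) (\<alpha> l) f x)" for l
  have u0: "u0 \<in> Y" "nrm u0 \<le> \<delta>\<^sup>2"
    using diff_mem[OF K f] f_near by (auto simp: u0_def)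
  have u: "u l \<in> Y" "nrm (u l) \<le> \<delta>\<^sup>2" if "l \<in> ?I" for l
    using diff_mem[OF K scale_mem[OF weighted_comp_mem[OF that f]]] T_near[OF that]
    by (auto simp: u_def)
  define bad where "bad v \<sigma> = {x \<in> K. \<delta> \<le> cmod (v (\<sigma> x))}" for v :: "'a \<Rightarrow> complex" and \<sigma>
  define \<B> where "\<B> = {bad u0 id} \<union> (\<lambda>l. bad u0 (\<alpha> l)) ` ?I \<union> (\<lambda>l. bad (u l) (inv (\<alpha> l))) ` ?I
    \<union> (\<lambda>(s, l). bad (u l) (inv (\<alpha> l) \<circ> \<alpha> s)) ` (?I \<times> ?I)"
  have fin: "finite \<B>" by (simp add: \<B>_def)
  define tiny where "tiny B \<longleftrightarrow> B \<in> sets borel \<and> indicator B \<in> Y \<and> nrm (indicator B) \<le> \<delta>" for B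
  have tiny: "tiny (bad v \<sigma>)"
    if "v \<in> Y" "nrm v \<le> \<delta>\<^sup>2" "comp_isometry \<sigma>" for v \<sigma>
    using nrm_indicator_large_set[OF that(1,3) Kb \<open>0 < \<delta>\<close> that(2)] by (simp add: bad_def tiny_def)
  have "tiny B" if "B \<in> \<B>" for B
    using that unfolding \<B>_def
    by (auto intro!: tiny u0 u comp_isometry_id comp_isometry_comp comp_isometry_\<alpha> comp_isometry_inv_\<alpha>)
  then have B: "B \<in> sets borel" "indicator B \<in> Y" "nrm (indicator B) \<le> \<delta>" if "B \<in> \<B>" for B
    using that by (auto simp: tiny_def)
  have "card \<B> \<le> 1 + N + N + N * N"
  proof -
    have "card ((\<lambda>l. bad u0 (\<alpha> l)) ` ?I) \<le> N" "card ((\<lambda>l. bad (u l) (inv (\<alpha> l))) ` ?I) \<le> N"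
      using card_image_le[of ?I] by (metis card_atLeastAtMost diff_Suc_1 finite_atLeastAtMost)+
    moreover have "card ((\<lambda>(s, l). bad (u l) (inv (\<alpha> l) \<circ> \<alpha> s)) ` (?I \<times> ?I)) \<le> N * N"
      by (rule order_trans[OF card_image_le]) (simp_all add: card_cartesian_product)
    ultimately show ?thesis
      unfolding \<B>_def by (intro order_trans[OF card_Un_le] add_mono) auto
  qed
  then have "real (card \<B>) \<le> real (1 + N + N + N * N)" by (simp only: of_nat_le_iff)
  then have card: "real (card \<B>) \<le> (real N + 1)\<^sup>2" by (simp add: power2_eq_square algebra_simps)
  define E where "E = K - \<Union>\<B>"
  have "E \<in> sets borel"
    unfolding E_def using Kb fin B by (intro sets.Diff sets.finite_Union) auto
  moreover have "E \<subseteq> K" by (auto simp: E_def)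
  moreover have "nrm (indicator (K - E)) \<le> (real N + 1)\<^sup>2 * \<delta>"
  proof -
    have "K - E = \<Union>\<B>" by (auto simp: E_def \<B>_def bad_def)
    then have "nrm (indicator (K - E)) \<le> real (card \<B>) * \<delta>"
      using nrm_indicator_Union_le[OF fin] B by simp
    also have "\<dots> \<le> (real N + 1)\<^sup>2 * \<delta>" using card \<open>0 < \<delta>\<close> by (intro mult_right_mono) auto
    finally show ?thesis .
  qed
  moreover have "weights_small E \<mu> (\<delta> / (1 - \<delta>))"
    unfolding weights_small_def
  proof (intro ballI conjI impI)
    fix l x assume l: "l \<in> ?I" and x: "x \<in> E"
    have xK: "x \<in> K" using x by (simp add: E_def)
    have good: "cmod (v (\<sigma> x)) < \<delta>" if "bad v \<sigma> \<in> \<B>" for v \<sigma>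
    proof -
      have "x \<notin> bad v \<sigma>" using x that unfolding E_def by blast
      then show ?thesis using xK unfolding bad_def by simp
    qed
    have f_one: "1 - \<delta> < cmod (f x)"
    proof -
      have "cmod (1 - f x) < \<delta>" using good[of u0 id] xK by (simp add: \<B>_def u0_def)
      then show ?thesis using norm_triangle_ineq2[of 1 "1 - f x"] by simp
    qed
    have T_one: "1 - \<delta> < \<mu> * w s x * cmod (f (\<alpha> s x))" if s: "s \<in> ?I" for s
    proof -
      have "bad (u s) (inv (\<alpha> s) \<circ> \<alpha> s) \<in> \<B>" using s by (auto simp: \<B>_def)
      then have "cmod (1 - complex_of_real \<mu> * weighted_comp (w s) (\<alpha> s) f x) < \<delta>"
        using good[of "u s"] xK s by (force simp: u_def)
      then have "1 - \<delta> < cmod (complex_of_real \<mu> * weighted_comp (w s) (\<alpha> s) f x)"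
        using norm_triangle_ineq2[of 1 "1 - complex_of_real \<mu> * weighted_comp (w s) (\<alpha> s) f x"]
        by simp
      then show ?thesis
        using \<open>0 < \<mu>\<close> w_pos[OF s, of x] by (simp add: weighted_comp_def norm_mult)
    qed
    have f_zero: "cmod (f (\<alpha> l x)) < \<delta>"
    proof -
      have "bad u0 (\<alpha> l) \<in> \<B>" using l by (auto simp: \<B>_def)
      moreover have "\<alpha> l x \<notin> K" using off[OF l] xK by blast
      ultimately show ?thesis using good[of u0] by (force simp: u0_def)
    qed
    have T_zero: "\<mu> * w l (inv (\<alpha> l) x) * cmod (f x) < \<delta>"
    proof -
      have "bad (u l) (inv (\<alpha> l)) \<in> \<B>" using l by (auto simp: \<B>_def)
      moreover have "inv (\<alpha> l) x \<notin> K"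
        using off[OF l] xK inv_right[OF l, of x] by (metis disjoint_iff imageI)
      ultimately show ?thesis
        using good[of "u l" "inv (\<alpha> l)"] \<open>0 < \<mu>\<close> w_pos[OF l] l
        by (simp add: u_def weighted_comp_def norm_mult less_imp_le)
    qed
    show "1 / w l x \<le> \<mu> * (\<delta> / (1 - \<delta>))"
    proof -
      have "\<mu> * w l x * cmod (f (\<alpha> l x)) \<le> \<mu> * w l x * \<delta>"
        using f_zero \<open>0 < \<mu>\<close> w_pos[OF l, of x] by (intro mult_left_mono) auto
      then have "1 - \<delta> \<le> \<mu> * w l x * \<delta>" using T_one[OF l] by linarith
      then show ?thesis using \<open>\<delta> < 1\<close> w_pos[OF l, of x] by (simp add: field_simps)
    qed
    show "w l (inv (\<alpha> l) x) \<le> \<delta> / (1 - \<delta>) / \<mu>"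
    proof -
      have "\<mu> * w l (inv (\<alpha> l) x) * (1 - \<delta>) \<le> \<mu> * w l (inv (\<alpha> l) x) * cmod (f x)"
        using f_one \<open>0 < \<mu>\<close> w_pos[OF l] by (intro mult_left_mono) (auto simp: less_imp_le)
      then have "\<mu> * w l (inv (\<alpha> l) x) * (1 - \<delta>) \<le> \<delta>" using T_zero by linarith
      then show ?thesis using \<open>\<delta> < 1\<close> \<open>0 < \<mu>\<close> by (simp add: field_simps)
    qed
    fix s assume s: "s \<in> ?I" and "s \<noteq> l"
    let ?y = "inv (\<alpha> l) (\<alpha> s x)" and ?a = "cmod (f (\<alpha> s x))"
    have "bad (u l) (inv (\<alpha> l) \<circ> \<alpha> s) \<in> \<B>" using s l by (force simp: \<B>_def)
    moreover have "?y \<notin> K" using off2[OF s l \<open>s \<noteq> l\<close>] xK by blast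
    ultimately have 1: "\<mu> * w l ?y * ?a < \<delta>"
      using good[of "u l" "inv (\<alpha> l) \<circ> \<alpha> s"] \<open>0 < \<mu>\<close> w_pos[OF l] l
      by (simp add: u_def weighted_comp_def norm_mult less_imp_le)
    have 2: "1 - \<delta> < \<mu> * w s x * ?a" by (rule T_one[OF s])
    have "?a \<noteq> 0" using 2 \<open>\<delta> < 1\<close> by auto
    then have "w l ?y / w s x = (\<mu> * w l ?y * ?a) / (\<mu> * w s x * ?a)"
      using \<open>0 < \<mu>\<close> by simp
    also have "\<dots> \<le> \<delta> / (1 - \<delta>)"
      using 1 2 \<open>0 < \<delta>\<close> \<open>\<delta> < 1\<close> by (intro frac_le) auto
    finally show "w l ?y / w s x \<le> \<delta> / (1 - \<delta>)" .
  qed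
  ultimately show thesis by (rule that)
qed

section \<open>From small weights to approximation\<close>

text \<open>With \<open>h\<^sub>s = g\<^sub>s \<chi>\<^sub>E\<close> one has \<open>\<mu> T\<^sub>l v = \<mu> T\<^sub>l (f \<chi>\<^sub>E) + h\<^sub>l + \<Sum>\<^sub>s\<^sub>\<noteq>\<^sub>l T\<^sub>l R\<^sub>s h\<^sub>s\<close>. The bound on
  \<open>w\<^sub>l \<circ> \<alpha>\<^sub>l\<inverse>\<close> controls the first term, that on the ratios \<open>(w\<^sub>l \<circ> \<alpha>\<^sub>l\<inverse> \<circ> \<alpha>\<^sub>s) / w\<^sub>s\<close> the
  last sum, and that on \<open>1 / w\<^sub>s\<close> the distance of \<open>v\<close> from \<open>f\<close>.\<close>

lemma approximate_from_weights_small: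
  assumes K: "indicator K \<in> Y" and E: "E \<in> sets borel" "E \<subseteq> K"
    and small: "weights_small E \<mu> \<eta>" and "0 < \<mu>" "0 \<le> \<eta>" "0 \<le> M"
    and f: "f \<in> Y" "\<And>x. cmod (f x) \<le> M * indicator K x"
    and g: "\<And>l. l \<in> {1..N} \<Longrightarrow> g l \<in> Y" "\<And>l x. l \<in> {1..N} \<Longrightarrow> cmod (g l x) \<le> M * indicator K x"
  defines "b \<equiv> M * nrm (indicator (K - E)) + (real N + 1) * (M * \<eta> * nrm (indicator K))"
  obtains v where "v \<in> Y" "nrm (\<lambda>x. f x - v x) \<le> b"
    "\<And>l. l \<in> {1..N} \<Longrightarrow>
      nrm (\<lambda>x. g l x - complex_of_real \<mu> * weighted_comp (w l) (\<alpha> l) v x) \<le> b"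
proof -
  let ?I = "{1..N}" and ?\<kappa> = "nrm (indicator K)"
  define cut where "cut h = (\<lambda>x. h x * indicator E x)" for h :: "'a \<Rightarrow> complex"
  define R where "R s h = (\<lambda>x. h (inv (\<alpha> s) x) / complex_of_real (w s (inv (\<alpha> s) x)))"
    for s and h :: "'a \<Rightarrow> complex"
  have Kb: "K \<in> sets borel"
    using measurable[OF K] by (simp add: borel_measurable_indicator_iff)
  have KE: "indicator (K - E) \<in> Y"
    using Kb E(1) by (intro conjunct1[OF solid[OF K]]) (auto simp: indicator_def)
  have cut_measurable: "cut h \<in> borel_measurable borel" if "h \<in> Y" for h
    unfolding cut_def using measurable[OF that] E(1) by measurable
  have cut_le: "cmod (cut h x) \<le> M * indicator E x" if "\<And>x. cmod (h x) \<le> M * indicator K x" for h x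
    using that[of x] E(2) by (auto simp: cut_def indicator_def)
  have cut_near: "(\<lambda>x. h x - cut h x) \<in> Y \<and> nrm (\<lambda>x. h x - cut h x) \<le> M * nrm (indicator (K - E))"
    if h: "h \<in> Y" and le: "\<And>x. cmod (h x) \<le> M * indicator K x" for h
  proof -
    have m: "(\<lambda>x. h x - cut h x) \<in> borel_measurable borel"
      using measurable[OF h] cut_measurable[OF h] by measurable
    have "cmod (h x - cut h x) \<le> M * cmod (indicator (K - E) (id x))" for x
      using le[of x] E(2) by (auto simp: cut_def indicator_def)
    from solid_along_isometry[OF KE comp_isometry_id m \<open>0 \<le> M\<close> this] show ?thesis by blast
  qed
  have cut_mem: "cut h \<in> Y" if h: "h \<in> Y" and le: "\<And>x. cmod (h x) \<le> M * indicator K x" for h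
    using diff_mem[OF h conjunct1[OF cut_near[OF h le]]] by simp
  have R_measurable: "R s h \<in> borel_measurable borel"
    if s: "s \<in> ?I" and h: "h \<in> borel_measurable borel" for s h
  proof -
    note [measurable] = measurable_inv_\<alpha>[OF s] w_measurable[OF s] h
    show ?thesis unfolding R_def by measurable
  qed
  have small1: "1 / w l x \<le> \<mu> * \<eta>" and small2: "w l (inv (\<alpha> l) x) \<le> \<eta> / \<mu>"
    if "l \<in> ?I" "x \<in> E" for l x
    using small that by (auto simp: weights_small_def)
  have small3: "w l (inv (\<alpha> l) (\<alpha> s x)) / w s x \<le> \<eta>"
    if "l \<in> ?I" "s \<in> ?I" "s \<noteq> l" "x \<in> E" for l s x
    using small that by (auto simp: weights_small_def)
  have R: "R s (cut (g s)) \<in> Y \<and> nrm (R s (cut (g s))) \<le> M * (\<mu> * \<eta>) * ?\<kappa>" if s: "s \<in> ?I" for s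
  proof -
    have C: "0 \<le> M * (\<mu> * \<eta>)" using \<open>0 \<le> M\<close> \<open>0 < \<mu>\<close> \<open>0 \<le> \<eta>\<close> by simp
    have "cmod (R s (cut (g s)) x) \<le> M * (\<mu> * \<eta>) * cmod (indicator K (inv (\<alpha> s) x))" for x
    proof (cases "inv (\<alpha> s) x \<in> E")
      case True
      let ?y = "inv (\<alpha> s) x"
      have "cmod (R s (cut (g s)) x) = cmod (cut (g s) ?y) * (1 / w s ?y)"
        using w_pos[OF s] by (simp add: R_def norm_divide less_imp_le)
      also have "\<dots> \<le> M * (\<mu> * \<eta>)"
        using cut_le[OF g(2)[OF s], of ?y] small1[OF s True] True w_pos[OF s, of ?y] \<open>0 \<le> M\<close>
        by (intro mult_mono) auto
      finally show ?thesis using True E(2) by auto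
    next
      case False
      then show ?thesis using C by (simp add: R_def cut_def)
    qed
    from solid_along_isometry[OF K comp_isometry_inv_\<alpha>[OF s]
        R_measurable[OF s cut_measurable[OF g(1)[OF s]]] C this] show ?thesis by blast
  qed
  define v where "v = (\<lambda>x. cut f x + complex_of_real (1 / \<mu>) * (\<Sum>s\<in>?I. R s (cut (g s)) x))"
  have sumR: "(\<lambda>x. \<Sum>s\<in>?I. R s (cut (g s)) x) \<in> Y"
    "nrm (\<lambda>x. \<Sum>s\<in>?I. R s (cut (g s)) x) \<le> real N * (M * (\<mu> * \<eta>) * ?\<kappa>)"
    using sum_mem_nrm_le[of ?I "\<lambda>s. R s (cut (g s))" "M * (\<mu> * \<eta>) * ?\<kappa>"] R by auto
  have v: "v \<in> Y" unfolding v_def by (intro add_mem scale_mem cut_mem f sumR(1))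
  have Mk: "0 \<le> M * \<eta> * ?\<kappa>"
    using \<open>0 \<le> M\<close> \<open>0 \<le> \<eta>\<close> nrm_nonneg[OF K] by simp
  have v_near: "nrm (\<lambda>x. f x - v x) \<le> b"
  proof -
    have eq: "(\<lambda>x. f x - v x) =
        (\<lambda>x. (f x - cut f x) - complex_of_real (1 / \<mu>) * (\<Sum>s\<in>?I. R s (cut (g s)) x))"
      by (simp add: v_def fun_eq_iff)
    have "nrm (\<lambda>x. f x - v x) \<le> M * nrm (indicator (K - E)) +
        cmod (complex_of_real (1 / \<mu>)) * nrm (\<lambda>x. \<Sum>s\<in>?I. R s (cut (g s)) x)"
      unfolding eq
      using nrm_diff_le[OF conjunct1[OF cut_near[OF f]] scale_mem[OF sumR(1), of "complex_of_real (1 / \<mu>)"]]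
        cut_near[OF f] nrm_scale[OF sumR(1), of "complex_of_real (1 / \<mu>)"] by linarith
    also have "\<dots> \<le> M * nrm (indicator (K - E)) + 1 / \<mu> * (real N * (M * (\<mu> * \<eta>) * ?\<kappa>))"
      using sumR(2) nrm_nonneg[OF sumR(1)] \<open>0 < \<mu>\<close>
      by (intro add_left_mono mult_mono) (auto simp: norm_divide)
    also have "\<dots> = M * nrm (indicator (K - E)) + real N * (M * \<eta> * ?\<kappa>)"
      using \<open>0 < \<mu>\<close> by simp
    also have "\<dots> \<le> b" using Mk by (simp add: b_def distrib_right)
    finally show ?thesis .
  qed
  have "nrm (\<lambda>x. g l x - complex_of_real \<mu> * weighted_comp (w l) (\<alpha> l) v x) \<le> b" if l: "l \<in> ?I" for l
  proof -
    note [measurable] = w_measurable[OF l] measurable_\<alpha>[OF l]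
    define p where "p = weighted_comp (w l) (\<alpha> l) (cut f)"
    define q where "q s = weighted_comp (w l) (\<alpha> l) (R s (cut (g s)))" for s
    have p: "p \<in> Y" "nrm p \<le> M * (\<eta> / \<mu>) * ?\<kappa>"
    proof -
      have C: "0 \<le> M * (\<eta> / \<mu>)" using \<open>0 \<le> M\<close> \<open>0 < \<mu>\<close> \<open>0 \<le> \<eta>\<close> by simp
      have le: "cmod (p x) \<le> M * (\<eta> / \<mu>) * cmod (indicator K (\<alpha> l x))" for x
      proof (cases "\<alpha> l x \<in> E")
        case True
        have "cmod (p x) = cmod (cut f (\<alpha> l x)) * w l x"
          using w_pos[OF l] by (simp add: p_def weighted_comp_def norm_mult less_imp_le)
        also have "\<dots> \<le> M * (\<eta> / \<mu>)"
          using cut_le[OF f(2), of "\<alpha> l x"] small2[OF l True] True w_pos[OF l, of x] \<open>0 \<le> M\<close> l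
          by (intro mult_mono) auto
        finally show ?thesis using True E(2) by auto
      next
        case False
        then show ?thesis
          using mult_nonneg_nonneg[OF C norm_ge_zero] by (simp add: p_def weighted_comp_def cut_def)
      qed
      show "p \<in> Y" unfolding p_def by (intro weighted_comp_mem l cut_mem f)
      then show "nrm p \<le> M * (\<eta> / \<mu>) * ?\<kappa>"
        using solid_along_isometry(2)[OF K comp_isometry_\<alpha>[OF l] measurable C le] by blast
    qed
    have q: "q s \<in> Y" "nrm (q s) \<le> M * \<eta> * ?\<kappa>" if s: "s \<in> ?I - {l}" for s
    proof -
      have s: "s \<in> ?I" "s \<noteq> l" using s by auto
      have C: "0 \<le> M * \<eta>" using \<open>0 \<le> M\<close> \<open>0 \<le> \<eta>\<close> by simp
      have le: "cmod (q s x) \<le> M * \<eta> * cmod (indicator K ((inv (\<alpha> s) \<circ> \<alpha> l) x))" for x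
      proof (cases "inv (\<alpha> s) (\<alpha> l x) \<in> E")
        case True
        let ?y = "inv (\<alpha> s) (\<alpha> l x)"
        have "cmod (q s x) = cmod (cut (g s) ?y) * (w l x / w s ?y)"
          using w_pos[OF l] w_pos[OF s(1)]
          by (simp add: q_def R_def weighted_comp_def norm_mult norm_divide less_imp_le)
        also have "\<dots> = cmod (cut (g s) ?y) * (w l (inv (\<alpha> l) (\<alpha> s ?y)) / w s ?y)"
          using l s(1) by simp
        also have "\<dots> \<le> M * \<eta>"
          using cut_le[OF g(2)[OF s(1)], of ?y] small3[OF l s True] True
            w_pos[OF l] w_pos[OF s(1), of ?y] \<open>0 \<le> M\<close>
          by (intro mult_mono divide_nonneg_pos) (auto simp: less_imp_le)
        finally show ?thesis using True E(2) by auto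
      next
        case False
        then show ?thesis using C by (simp add: q_def R_def weighted_comp_def cut_def)
      qed
      show "q s \<in> Y" unfolding q_def by (intro weighted_comp_mem l conjunct1[OF R] s)
      then show "nrm (q s) \<le> M * \<eta> * ?\<kappa>"
        using solid_along_isometry(2)[OF K
            comp_isometry_comp[OF comp_isometry_inv_\<alpha>[OF s(1)] comp_isometry_\<alpha>[OF l]] measurable C le]
        by blast
    qed
    have sumq: "(\<lambda>x. \<Sum>s\<in>?I - {l}. q s x) \<in> Y"
      "nrm (\<lambda>x. \<Sum>s\<in>?I - {l}. q s x) \<le> real N * (M * \<eta> * ?\<kappa>)"
    proof -
      have "nrm (\<lambda>x. \<Sum>s\<in>?I - {l}. q s x) \<le> real (card (?I - {l})) * (M * \<eta> * ?\<kappa>)"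
        and "(\<lambda>x. \<Sum>s\<in>?I - {l}. q s x) \<in> Y"
        using sum_mem_nrm_le[of "?I - {l}" q] q by auto
      moreover have "real (card (?I - {l})) * (M * \<eta> * ?\<kappa>) \<le> real N * (M * \<eta> * ?\<kappa>)"
        using Mk l by (intro mult_right_mono) auto
      ultimately show "(\<lambda>x. \<Sum>s\<in>?I - {l}. q s x) \<in> Y"
        "nrm (\<lambda>x. \<Sum>s\<in>?I - {l}. q s x) \<le> real N * (M * \<eta> * ?\<kappa>)" by auto
    qed
    have ql: "q l x = cut (g l) x" for x
      using w_pos[OF l, of x] l by (simp add: q_def R_def weighted_comp_def)
    have "complex_of_real \<mu> * weighted_comp (w l) (\<alpha> l) v x =
        complex_of_real \<mu> * p x + (\<Sum>s\<in>?I. q s x)" for x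
      using \<open>0 < \<mu>\<close>
      by (simp add: v_def p_def q_def weighted_comp_def distrib_left sum_distrib_left mult.assoc mult.left_commute)
    moreover have "(\<Sum>s\<in>?I. q s x) = cut (g l) x + (\<Sum>s\<in>?I - {l}. q s x)" for x
      using sum.remove[of ?I l "\<lambda>s. q s x"] l ql by simp
    ultimately have eq: "(\<lambda>x. g l x - complex_of_real \<mu> * weighted_comp (w l) (\<alpha> l) v x) =
        (\<lambda>x. (g l x - cut (g l) x) - (complex_of_real \<mu> * p x + (\<Sum>s\<in>?I - {l}. q s x)))"
      by (simp only: algebra_simps)
    have "nrm (\<lambda>x. g l x - complex_of_real \<mu> * weighted_comp (w l) (\<alpha> l) v x) \<le>
        nrm (\<lambda>x. g l x - cut (g l) x) +
        (cmod (complex_of_real \<mu>) * nrm p + nrm (\<lambda>x. \<Sum>s\<in>?I - {l}. q s x))"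
      unfolding eq
      using nrm_diff_le[OF conjunct1[OF cut_near[OF g(1)[OF l] g(2)[OF l]]]
          add_mem[OF scale_mem[OF p(1), of "complex_of_real \<mu>"] sumq(1)]]
        nrm_triangle[OF scale_mem[OF p(1), of "complex_of_real \<mu>"] sumq(1)]
        nrm_scale[OF p(1), of "complex_of_real \<mu>"] by linarith
    also have "\<dots> \<le> M * nrm (indicator (K - E)) + (\<mu> * (M * (\<eta> / \<mu>) * ?\<kappa>) + real N * (M * \<eta> * ?\<kappa>))"
      using cut_near[OF g(1)[OF l] g(2)[OF l]] mult_left_mono[OF p(2), of \<mu>] sumq(2) \<open>0 < \<mu>\<close>
      by (intro add_mono) auto
    also have "\<dots> = b" using \<open>0 < \<mu>\<close> by (simp add: b_def distrib_right)
    finally show ?thesis .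
  qed
  with v v_near show thesis by (rule that)
qed

end

section \<open>The characterization\<close>

theorem theorem5p3:
  fixes Y :: "('a::topological_space \<Rightarrow> complex) set"
    and nrm :: "('a \<Rightarrow> complex) \<Rightarrow> real"
    and S :: "'t set" and \<F> :: "'t set set" and N :: nat
    and \<alpha> :: "'t \<Rightarrow> nat \<Rightarrow> 'a \<Rightarrow> 'a" and w :: "'t \<Rightarrow> nat \<Rightarrow> 'a \<Rightarrow> real"
  assumes "solid_banach_function_space Y nrm"
    and "\<And>K. compact K \<Longrightarrow> indicator K \<in> Y"
    and "nrm_topology Y nrm closure_of bounded_compactly_supported Y = Y"
    and "\<F> \<subseteq> Pow S" and "1 \<le> N"
    and "\<And>t l. t \<in> S \<Longrightarrow> l \<in> {1..N} \<Longrightarrow> self_homeomorphism (\<alpha> t l)"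
    and "\<And>t l. t \<in> S \<Longrightarrow> l \<in> {1..N} \<Longrightarrow> comp_invariant Y nrm (\<alpha> t l)"
    and "disjoint_aperiodic \<F> N \<alpha>"
    and "\<And>t l. t \<in> S \<Longrightarrow> l \<in> {1..N} \<Longrightarrow> admissible_weight (w t l)"
  shows
    "d_semi_transitive (nrm_topology Y nrm) (\<lambda>c f x. complex_of_real c * f x) \<F> N
       (\<lambda>t l. weighted_comp (w t l) (\<alpha> t l))
     \<longleftrightarrow>
     (\<forall>\<epsilon>::real. \<forall>K. 0 < \<epsilon> \<and> \<epsilon> < 1 \<and> compact K \<longrightarrow>
       (\<exists>F\<in>\<F>. \<exists>E. (\<forall>t\<in>F. E t \<in> sets borel \<and> E t \<subseteq> K) \<and>
         (\<forall>t\<in>F.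
            nrm (indicator (K - E t)) < (4 + 2 * real N) * real N * \<epsilon> \<and>
            (\<forall>l\<in>{1..N}. \<forall>s\<in>{1..N}.
               (SUP x\<in>E t. ennreal (1 / w t s x)) *
               (SUP x\<in>E t. ennreal (w t l (inv (\<alpha> t l) x)))
                 < ennreal (\<epsilon>\<^sup>2 / (1 - \<epsilon>)\<^sup>2)) \<and>
            (\<forall>s\<in>{1..N}. \<forall>l\<in>{1..N}. s \<noteq> l \<longrightarrow>
               (SUP x\<in>E t. ennreal (w t l (inv (\<alpha> t l) (\<alpha> t s x)) / w t s x))
                 < ennreal (\<epsilon> / (1 - \<epsilon>))))))"
proof -
  interpret solid_banach_function_space Y nrm by fact
  let ?Z = "nrm_topology Y nrm" and ?I = "{1..N}"
  have tuple: "weighted_comp_tuple Y nrm N (\<alpha> t) (w t)" if "t \<in> F" "F \<in> \<F>" for t F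
  proof unfold_locales
    have "t \<in> S" using that assms(4) by blast
    then show "self_homeomorphism (\<alpha> t l)" "comp_invariant Y nrm (\<alpha> t l)" "admissible_weight (w t l)"
      if "l \<in> ?I" for l using assms(6,7,9) that by auto
  qed
  show ?thesis
  proof (intro iffI allI impI)
    fix \<epsilon> :: real and K :: "'a set"
    assume trans: "d_semi_transitive ?Z (\<lambda>c f x. complex_of_real c * f x) \<F> N
        (\<lambda>t l. weighted_comp (w t l) (\<alpha> t l))"
      and "0 < \<epsilon> \<and> \<epsilon> < 1 \<and> compact K"
    then have \<epsilon>: "0 < \<epsilon>" "\<epsilon> < 1" and "compact K" by auto
    have K: "indicator K \<in> Y" by (rule assms(2)[OF \<open>compact K\<close>])
    \<comment> \<open>The estimates for \<open>\<delta>\<close> bound the suprema only non-strictly; any \<open>\<delta> < \<epsilon>\<close> makes the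
      required inequalities strict.\<close>
    define \<delta> where "\<delta> = \<epsilon> / 2"
    have \<delta>: "0 < \<delta>" "\<delta> < 1" using \<epsilon> by (auto simp: \<delta>_def)
    define U where "U = {g \<in> Y. nrm (\<lambda>x. indicator K x - g x) < \<delta>\<^sup>2}"
    have "openin ?Z U" unfolding U_def by (rule openin_nrm_ball[OF K])
    moreover have "indicator K \<in> U" using K \<delta>(1) by (simp add: U_def nrm_zero)
    ultimately have "openin ?Z U \<and> U \<noteq> {}" by blast
    then have "\<exists>H\<in>\<F>. \<forall>t\<in>H. \<exists>c>0.
        U \<inter> (\<Inter>l\<in>?I. (\<lambda>f x. complex_of_real c * f x) `
          {z \<in> topspace ?Z. weighted_comp (w t l) (\<alpha> t l) z \<in> U}) \<noteq> {}"
      using trans[unfolded d_semi_transitive_def, THEN spec[of _ U], THEN spec[of _ "\<lambda>_. U"]]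
      by (simp only: simp_thms ball_triv)
    then obtain H where H: "H \<in> \<F>" and near: "\<forall>t\<in>H. \<exists>c>0.
        U \<inter> (\<Inter>l\<in>?I. (\<lambda>f x. complex_of_real c * f x) `
          {z \<in> topspace ?Z. weighted_comp (w t l) (\<alpha> t l) z \<in> U}) \<noteq> {}" ..
    have "\<exists>F\<in>\<F>. F \<subseteq> H \<and> (\<forall>t\<in>F. (\<forall>l\<in>?I. K \<inter> \<alpha> t l ` K = {}) \<and>
        (\<forall>s\<in>?I. \<forall>l\<in>?I. s \<noteq> l \<longrightarrow> inv (\<alpha> t l) ` (\<alpha> t s ` K) \<inter> K = {}))"
      using assms(8) \<open>compact K\<close> H unfolding disjoint_aperiodic_def by (elim allE impE)
    then obtain F where F: "F \<in> \<F>" "F \<subseteq> H"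
      and off: "\<And>t l. t \<in> F \<Longrightarrow> l \<in> ?I \<Longrightarrow> K \<inter> \<alpha> t l ` K = {}"
      and off2: "\<And>t s l. t \<in> F \<Longrightarrow> s \<in> ?I \<Longrightarrow> l \<in> ?I \<Longrightarrow> s \<noteq> l \<Longrightarrow>
        inv (\<alpha> t l) ` (\<alpha> t s ` K) \<inter> K = {}"
      by (elim bexE conjE) metis
    let ?good = "\<lambda>t E. E \<in> sets borel \<and> E \<subseteq> K \<and>
        nrm (indicator (K - E)) \<le> (real N + 1)\<^sup>2 * \<delta> \<and>
        (\<exists>\<mu>>0. weighted_comp_tuple.weights_small N (\<alpha> t) (w t) E \<mu> (\<delta> / (1 - \<delta>)))"
    have "\<exists>E. ?good t E" if t: "t \<in> F" for t
    proof -
      interpret t: weighted_comp_tuple Y nrm N "\<alpha> t" "w t" by (rule tuple[OF t F(1)])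
      obtain c f where "0 < c" and f: "f \<in> U"
        and im: "\<And>l. l \<in> ?I \<Longrightarrow> f \<in> (\<lambda>f x. complex_of_real c * f x) `
          {z \<in> topspace ?Z. weighted_comp (w t l) (\<alpha> t l) z \<in> U}"
        using bspec[OF near subsetD[OF F(2) t]] by (elim exE conjE) blast
      have T: "nrm (\<lambda>x. indicator K x - complex_of_real (1 / c) * weighted_comp (w t l) (\<alpha> t l) f x) \<le> \<delta>\<^sup>2"
        if l: "l \<in> ?I" for l
      proof -
        obtain z where z: "f = (\<lambda>x. complex_of_real c * z x)" "weighted_comp (w t l) (\<alpha> t l) z \<in> U"
          using im[OF l] by blast
        have "complex_of_real (1 / c) * weighted_comp (w t l) (\<alpha> t l) f x =
            weighted_comp (w t l) (\<alpha> t l) z x" for x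
          using \<open>0 < c\<close> by (simp add: z(1) weighted_comp_def)
        then show ?thesis using z(2) by (simp add: U_def)
      qed
      have c': "0 < 1 / c" using \<open>0 < c\<close> by simp
      have f': "f \<in> Y" "nrm (\<lambda>x. indicator K x - f x) \<le> \<delta>\<^sup>2" using f by (auto simp: U_def)
      show ?thesis
      proof (rule t.weights_small_from_near_indicators[OF K off[OF t] off2[OF t] f'(1) c' \<delta> f'(2) T])
        fix E assume "E \<in> sets borel" "E \<subseteq> K" "nrm (indicator (K - E)) \<le> (real N + 1)\<^sup>2 * \<delta>"
          "t.weights_small E (1 / c) (\<delta> / (1 - \<delta>))"
        then show ?thesis using c' by blast
      qed
    qed
    then obtain E where E: "\<And>t. t \<in> F \<Longrightarrow> ?good t (E t)" by metis
    have \<delta>\<epsilon>: "0 \<le> \<delta> / (1 - \<delta>)" "\<delta> / (1 - \<delta>) < \<epsilon> / (1 - \<epsilon>)"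
      using \<epsilon> by (auto simp: \<delta>_def field_simps)
    have N: "(real N + 1)\<^sup>2 * \<delta> < (4 + 2 * real N) * real N * \<epsilon>"
    proof (rule mult_le_less_imp_less)
      have "1 \<le> real N" using assms(5) by simp
      then have "1 \<le> real N * real N" using mult_mono[of 1 "real N" 1 "real N"] by simp
      then show "(real N + 1)\<^sup>2 \<le> (4 + 2 * real N) * real N"
        using \<open>1 \<le> real N\<close> by (simp add: power2_eq_square algebra_simps)
      show "\<delta> < \<epsilon>" using \<epsilon> by (simp add: \<delta>_def)
    qed (use \<delta> in auto)
    show "\<exists>F\<in>\<F>. \<exists>E. (\<forall>t\<in>F. E t \<in> sets borel \<and> E t \<subseteq> K) \<and>
         (\<forall>t\<in>F.
            nrm (indicator (K - E t)) < (4 + 2 * real N) * real N * \<epsilon> \<and>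
            (\<forall>l\<in>{1..N}. \<forall>s\<in>{1..N}.
               (SUP x\<in>E t. ennreal (1 / w t s x)) *
               (SUP x\<in>E t. ennreal (w t l (inv (\<alpha> t l) x)))
                 < ennreal (\<epsilon>\<^sup>2 / (1 - \<epsilon>)\<^sup>2)) \<and>
            (\<forall>s\<in>{1..N}. \<forall>l\<in>{1..N}. s \<noteq> l \<longrightarrow>
               (SUP x\<in>E t. ennreal (w t l (inv (\<alpha> t l) (\<alpha> t s x)) / w t s x))
                 < ennreal (\<epsilon> / (1 - \<epsilon>))))"
    proof (intro bexI[OF _ F(1)] exI[of _ E] conjI ballI impI)
      fix t assume t: "t \<in> F"
      interpret t: weighted_comp_tuple Y nrm N "\<alpha> t" "w t" by (rule tuple[OF t F(1)])
      obtain \<mu> where \<mu>: "0 < \<mu>" "t.weights_small (E t) \<mu> (\<delta> / (1 - \<delta>))"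
        using E[OF t] by blast
      show "E t \<in> sets borel" "E t \<subseteq> K" using E[OF t] by auto
      show "nrm (indicator (K - E t)) < (4 + 2 * real N) * real N * \<epsilon>"
        using E[OF t] N by linarith
      note sup = t.sup_small_if_weights_small[OF \<mu>(2,1) \<delta>\<epsilon>]
      show "(SUP x\<in>E t. ennreal (1 / w t s x)) * (SUP x\<in>E t. ennreal (w t l (inv (\<alpha> t l) x)))
          < ennreal (\<epsilon>\<^sup>2 / (1 - \<epsilon>)\<^sup>2)" if "l \<in> ?I" "s \<in> ?I" for l s
        using sup(1)[OF that] by (simp add: power_divide)
      show "(SUP x\<in>E t. ennreal (w t l (inv (\<alpha> t l) (\<alpha> t s x)) / w t s x)) < ennreal (\<epsilon> / (1 - \<epsilon>))"
        if "s \<in> ?I" "l \<in> ?I" "s \<noteq> l" for s l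
        by (rule sup(2)[OF that(2,1,3)])
    qed
  next
    assume small: "\<forall>\<epsilon>::real. \<forall>K. 0 < \<epsilon> \<and> \<epsilon> < 1 \<and> compact K \<longrightarrow>
       (\<exists>F\<in>\<F>. \<exists>E. (\<forall>t\<in>F. E t \<in> sets borel \<and> E t \<subseteq> K) \<and>
         (\<forall>t\<in>F.
            nrm (indicator (K - E t)) < (4 + 2 * real N) * real N * \<epsilon> \<and>
            (\<forall>l\<in>{1..N}. \<forall>s\<in>{1..N}.
               (SUP x\<in>E t. ennreal (1 / w t s x)) *
               (SUP x\<in>E t. ennreal (w t l (inv (\<alpha> t l) x)))
                 < ennreal (\<epsilon>\<^sup>2 / (1 - \<epsilon>)\<^sup>2)) \<and>
            (\<forall>s\<in>{1..N}. \<forall>l\<in>{1..N}. s \<noteq> l \<longrightarrow>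
               (SUP x\<in>E t. ennreal (w t l (inv (\<alpha> t l) (\<alpha> t s x)) / w t s x))
                 < ennreal (\<epsilon> / (1 - \<epsilon>)))))"
    show "d_semi_transitive ?Z (\<lambda>c f x. complex_of_real c * f x) \<F> N
        (\<lambda>t l. weighted_comp (w t l) (\<alpha> t l))"
      unfolding d_semi_transitive_def
    proof (intro allI impI)
      fix U V
      assume UV: "openin ?Z U \<and> U \<noteq> {} \<and> (\<forall>l\<in>?I. openin ?Z (V l) \<and> V l \<noteq> {})"
      \<comment> \<open>\<open>U\<close> gets the index \<open>0\<close>, so that the open sets form one finite family.\<close>
      define W where "W i = (if i = 0 then U else V i)" for i
      have W: "openin ?Z (W i)" "W i \<noteq> {}" if "i \<le> N" for i
        using UV that by (auto simp: W_def)
      have "\<exists>f r. f \<in> W i \<and> f \<in> bounded_compactly_supported Y \<and> 0 < r \<and>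
          (\<forall>h\<in>Y. nrm (\<lambda>x. f x - h x) < r \<longrightarrow> h \<in> W i)" if i: "i \<le> N" for i
      proof -
        have "W i \<inter> (?Z closure_of bounded_compactly_supported Y) \<noteq> {}"
          using W[OF i] assms(3) openin_subset[OF W(1)[OF i]]
          by (auto simp: topspace_nrm_topology)
        then obtain f where "f \<in> W i" "f \<in> bounded_compactly_supported Y"
          using openin_Int_closure_of_eq_empty[OF W(1)[OF i]] by blast
        then show ?thesis using W(1)[OF i] unfolding openin_nrm_topology_iff by blast
      qed
      then obtain f r where fr: "\<And>i. i \<le> N \<Longrightarrow> f i \<in> bounded_compactly_supported Y \<and> 0 < r i \<and>
          (\<forall>h\<in>Y. nrm (\<lambda>x. f i x - h x) < r i \<longrightarrow> h \<in> W i)"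
        by metis
      define K where "K = (\<Union>i\<le>N. closure {x. f i x \<noteq> 0})"
      have "compact K"
        unfolding K_def using fr by (intro compact_UN) (auto simp: bounded_compactly_supported_def)
      have K: "indicator K \<in> Y" by (rule assms(2)[OF \<open>compact K\<close>])
      have "bounded (\<Union>i\<le>N. range (f i))"
        using fr by (auto simp: bounded_compactly_supported_def)
      then obtain M where "0 < M" and M_bound: "\<forall>y\<in>(\<Union>i\<le>N. range (f i)). cmod y \<le> M"
        unfolding bounded_pos by blast
      then have M: "0 < M" "\<And>i x. i \<le> N \<Longrightarrow> cmod (f i x) \<le> M" by auto
      have fK: "cmod (f i x) \<le> M * indicator K x" if "i \<le> N" for i x
      proof (cases "f i x = 0")
        case False
        then have "x \<in> closure {x. f i x \<noteq> 0}" by (intro subsetD[OF closure_subset]) simp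
        then have "x \<in> K" using that by (auto simp: K_def)
        then show ?thesis using M(2)[OF that] by simp
      qed (use M(1) in simp)
      define r0 where "r0 = Min (r ` {..N})"
      have r0: "0 < r0" "\<And>i. i \<le> N \<Longrightarrow> r0 \<le> r i"
        using fr by (auto simp: r0_def)
      \<comment> \<open>For \<open>\<epsilon> \<le> 1/2\<close> one has \<open>\<epsilon> / (1 - \<epsilon>) \<le> 2 \<epsilon>\<close>, so the error of the approximation is at
        most \<open>C \<epsilon>\<close>.\<close>
      define C where "C = M * ((4 + 2 * real N) * real N) + (real N + 1) * (M * 2 * nrm (indicator K))"
      have "0 \<le> C" unfolding C_def using M(1) nrm_nonneg[OF K] by simp
      define \<epsilon> where "\<epsilon> = min (1 / 2) (r0 / (C + 1))"
      define \<eta> where "\<eta> = \<epsilon> / (1 - \<epsilon>)"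
      have \<epsilon>: "0 < \<epsilon>" "\<epsilon> \<le> 1 / 2"
        unfolding \<epsilon>_def using r0(1) \<open>0 \<le> C\<close> min.cobounded1[of "1 / 2"] by (force, blast)
      have "\<epsilon> * C < r0"
      proof -
        have "\<epsilon> \<le> r0 / (C + 1)" by (simp add: \<epsilon>_def)
        then have "\<epsilon> * (C + 1) \<le> r0" using \<open>0 \<le> C\<close> by (simp add: pos_le_divide_eq)
        then show ?thesis using \<epsilon>(1) by (simp add: distrib_left)
      qed
      have "\<epsilon> * \<epsilon> * 2 \<le> \<epsilon>" using mult_left_mono[OF \<epsilon>(2), of \<epsilon>] \<epsilon>(1) by simp
      then have \<eta>: "0 < \<eta>" "\<eta> \<le> 2 * \<epsilon>" using \<epsilon> by (auto simp: \<eta>_def pos_divide_le_eq algebra_simps)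
      have \<epsilon>K: "0 < \<epsilon> \<and> \<epsilon> < 1 \<and> compact K" using \<epsilon> \<open>compact K\<close> by simp
      obtain F E where F: "F \<in> \<F>" and E: "\<forall>t\<in>F. E t \<in> sets borel \<and> E t \<subseteq> K"
        and bounds: "\<forall>t\<in>F.
            nrm (indicator (K - E t)) < (4 + 2 * real N) * real N * \<epsilon> \<and>
            (\<forall>l\<in>{1..N}. \<forall>s\<in>{1..N}.
               (SUP x\<in>E t. ennreal (1 / w t s x)) *
               (SUP x\<in>E t. ennreal (w t l (inv (\<alpha> t l) x)))
                 < ennreal (\<epsilon>\<^sup>2 / (1 - \<epsilon>)\<^sup>2)) \<and>
            (\<forall>s\<in>{1..N}. \<forall>l\<in>{1..N}. s \<noteq> l \<longrightarrow>
               (SUP x\<in>E t. ennreal (w t l (inv (\<alpha> t l) (\<alpha> t s x)) / w t s x))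
                 < ennreal (\<epsilon> / (1 - \<epsilon>)))"
        using small[THEN spec, THEN spec, THEN mp, OF \<epsilon>K] by (elim bexE exE conjE)
      show "\<exists>F\<in>\<F>. \<forall>t\<in>F. \<exists>c>0. U \<inter> (\<Inter>l\<in>?I. (\<lambda>f x. complex_of_real c * f x) `
          {z \<in> topspace ?Z. weighted_comp (w t l) (\<alpha> t l) z \<in> V l}) \<noteq> {}"
      proof (intro bexI[OF _ F] ballI)
        fix t assume t: "t \<in> F"
        interpret t: weighted_comp_tuple Y nrm N "\<alpha> t" "w t" by (rule tuple[OF t F])
        note bounds_t = bspec[OF bounds t, folded power_divide \<eta>_def]
        have KE: "nrm (indicator (K - E t)) < (4 + 2 * real N) * real N * \<epsilon>"
          by (rule conjunct1[OF bounds_t])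
        have "\<exists>\<mu>>0. t.weights_small (E t) \<mu> \<eta>"
          using bounds_t \<eta>(1) by (intro t.weights_small_if_sup_small) simp_all
        then obtain \<mu> where \<mu>: "0 < \<mu>" "t.weights_small (E t) \<mu> \<eta>" by blast
        have fY: "f i \<in> Y" if "i \<le> N" for i
          using fr[OF that] by (simp add: bounded_compactly_supported_def)
        obtain v where v: "v \<in> Y" and near:
          "nrm (\<lambda>x. f 0 x - v x) \<le> M * nrm (indicator (K - E t)) + (real N + 1) * (M * \<eta> * nrm (indicator K))"
          "\<And>l. l \<in> ?I \<Longrightarrow> nrm (\<lambda>x. f l x - complex_of_real \<mu> * weighted_comp (w t l) (\<alpha> t l) v x)
            \<le> M * nrm (indicator (K - E t)) + (real N + 1) * (M * \<eta> * nrm (indicator K))"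
          using t.approximate_from_weights_small[OF K, of "E t" \<mu> \<eta> M "f 0" f]
            bspec[OF E t] \<mu> \<eta>(1) M(1) fY fK by auto
        have "M * nrm (indicator (K - E t)) + (real N + 1) * (M * \<eta> * nrm (indicator K))
            \<le> M * ((4 + 2 * real N) * real N * \<epsilon>) + (real N + 1) * (M * (2 * \<epsilon>) * nrm (indicator K))"
          using KE \<eta>(2) M(1) nrm_nonneg[OF K]
          by (intro add_mono mult_left_mono mult_right_mono) auto
        also have "\<dots> = \<epsilon> * C" by (simp add: C_def algebra_simps)
        also have "\<dots> < r0" by fact
        finally have b: "M * nrm (indicator (K - E t)) + (real N + 1) * (M * \<eta> * nrm (indicator K)) < r0" .
        have "v \<in> U" using fr[of 0] near(1) b r0(2)[of 0] v by (force simp: W_def)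
        moreover have "v \<in> (\<lambda>f x. complex_of_real (1 / \<mu>) * f x) `
            {z \<in> topspace ?Z. weighted_comp (w t l) (\<alpha> t l) z \<in> V l}" if l: "l \<in> ?I" for l
        proof (rule image_eqI)
          show "v = (\<lambda>x. complex_of_real (1 / \<mu>) * (complex_of_real \<mu> * v x))"
            using \<mu>(1) by (simp add: fun_eq_iff)
          have eq: "weighted_comp (w t l) (\<alpha> t l) (\<lambda>x. complex_of_real \<mu> * v x) =
              (\<lambda>x. complex_of_real \<mu> * weighted_comp (w t l) (\<alpha> t l) v x)"
            by (simp add: weighted_comp_def fun_eq_iff)
          have "(\<lambda>x. complex_of_real \<mu> * weighted_comp (w t l) (\<alpha> t l) v x) \<in> Y"
            by (intro scale_mem t.weighted_comp_mem l v)
          moreover have "nrm (\<lambda>x. f l x - complex_of_real \<mu> * weighted_comp (w t l) (\<alpha> t l) v x) < r l"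
            using near(2)[OF l] b r0(2)[of l] l by simp
          ultimately have "(\<lambda>x. complex_of_real \<mu> * weighted_comp (w t l) (\<alpha> t l) v x) \<in> W l"
            using fr[of l] l by auto
          then show "(\<lambda>x. complex_of_real \<mu> * v x) \<in>
              {z \<in> topspace ?Z. weighted_comp (w t l) (\<alpha> t l) z \<in> V l}"
            using l scale_mem[OF v] by (auto simp: eq topspace_nrm_topology W_def)
        qed
        ultimately show "\<exists>c>0. U \<inter> (\<Inter>l\<in>?I. (\<lambda>f x. complex_of_real c * f x) `
            {z \<in> topspace ?Z. weighted_comp (w t l) (\<alpha> t l) z \<in> V l}) \<noteq> {}"
          using \<mu>(1) by (intro exI[of _ "1 / \<mu>"]) auto
      qed
    qed
  qed
qed

end
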